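(* Let $G$ be a connected graph. Then any connected graph that is orbitally similar to $G$ has the same spectral radius as $G$. In particular, if $\{G_k:k\geq 1\}$ is a self-similar sequence emanating from $G$, then $\varrho(G_k)=\varrho(G)$ for all $k\geq 1$.
   Context: All graphs are finite, undirected, without loops and multiple edges. $|G|$ is the number of vertices of $G$, and $\varrho(G)$ is the spectral radius of the adjacency matrix of $G$. Two vertices $u,v$ of $G$ are automorphically similar if $\varphi(u)=v$ for some automorphism $\varphi$ of $G$; the equivalence classes $\mathcal O_1,\ldots,\mathcal O_\ell$ are the orbits of $G$. Given an ordering $(\mathcal O_1,\ldots,\mathcal O_\ell)$ of the orbits, the orbit divisor matrix of $G$ is $S_G=[s_{i,j}]_{i,j=1}^{\ell}$, where $s_{i,j}$ is the number of vertices in $\mathcal O_j$ adjacent to a vertex $u\in\mathcal O_i$ (this does not depend on the choice of $u\in\mathcal O_i$). Two connected graphs $G$ and $H$, possibly of different order, are orbitally similar if they have the same number of orbits and $S_G=S_H$ for suitable orderings of the orbits of $G$ and of the orbits of $H$. A self-similar sequence emanating from a connected graph $G$ is a sequence $\{G_k:k\geq 1\}$ of connected graphs such that $|G_1|<|G_2|<|G_3|<\cdots$, the graphs $G_1,G_2,G_3,\ldots$ are pairwise orbitally similar, and $G_1$ is isomorphic to $G$. *)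

theory Defs
  imports
    "Graph_Theory.Graph_Theory"
    "Jordan_Normal_Form.Spectral_Radius"
begin

text \<open>
  A finite undirected graph without loops and multiple edges is a \<^term>\<open>pair_graph\<close>:
  the arc set is a finite, symmetric, irreflexive relation on the finite vertex set.
  The library's notion of connectedness excludes the graph without vertices.
\<close>

definition connected_graph :: "'a pair_pre_digraph \<Rightarrow> bool" where
  "connected_graph G \<longleftrightarrow> pair_graph G \<and> Digraph_Component.connected (with_proj G)"


subsection \<open>Spectral radius of a graph\<close>

definition adjacency_mat :: "'a pair_pre_digraph \<Rightarrow> 'a list \<Rightarrow> complex mat" where
  "adjacency_mat G vs =
     mat (length vs) (length vs) (\<lambda>(i, j). if (vs ! i, vs ! j) \<in> parcs G then 1 else 0)"

text \<open>The enumeration of the vertices is irrelevant, see \<open>graph_spectral_radius_eq\<close> below.\<close>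

definition graph_spectral_radius :: "'a pair_pre_digraph \<Rightarrow> real" where
  "graph_spectral_radius G =
     spectral_radius (adjacency_mat G (SOME vs. distinct vs \<and> set vs = pverts G))"

lemma sum_nth_distinct:
  assumes "distinct vs"
  shows "(\<Sum>i = 0..<length vs. g (vs ! i)) = sum g (set vs)"
proof -
  have "bij_betw ((!) vs) {0..<length vs} (set vs)"
    using assms by (simp add: bij_betw_nth atLeast0LessThan)
  then show ?thesis by (rule sum.reindex_bij_betw)
qed

lemma adjacency_mat_mult_vec:
  assumes "distinct vs" and "i < length vs"
  shows "(adjacency_mat G vs *\<^sub>v vec (length vs) (\<lambda>j. f (vs ! j))) $ i
    = (\<Sum>w | w \<in> set vs \<and> (vs ! i, w) \<in> parcs G. f w)"
proof -
  have "(adjacency_mat G vs *\<^sub>v vec (length vs) (\<lambda>j. f (vs ! j))) $ i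
    = (\<Sum>j = 0..<length vs. (if (vs ! i, vs ! j) \<in> parcs G then f (vs ! j) else 0))"
    using assms(2) by (auto simp: adjacency_mat_def scalar_prod_def intro!: sum.cong)
  also have "\<dots> = (\<Sum>w\<in>set vs. if (vs ! i, w) \<in> parcs G then f w else 0)"
    by (rule sum_nth_distinct[OF assms(1)])
  also have "\<dots> = (\<Sum>w | w \<in> set vs \<and> (vs ! i, w) \<in> parcs G. f w)"
    by (simp add: sum.If_cases Int_def)
  finally show ?thesis .
qed

lemma eigenvalue_adjacency_mat_iff:
  assumes "distinct vs"
  shows "eigenvalue (adjacency_mat G vs) k \<longleftrightarrow>
    (\<exists>f. (\<exists>u\<in>set vs. f u \<noteq> 0) \<and>
         (\<forall>u\<in>set vs. (\<Sum>w | w \<in> set vs \<and> (u, w) \<in> parcs G. f w) = k * f u))"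
    (is "?L \<longleftrightarrow> ?R")
proof
  let ?n = "length vs"
  assume ?L
  then obtain v where v: "v \<in> carrier_vec ?n" "v \<noteq> 0\<^sub>v ?n"
    "adjacency_mat G vs *\<^sub>v v = k \<cdot>\<^sub>v v"
    by (auto simp: eigenvalue_def eigenvector_def adjacency_mat_def)
  define f where "f u = v $ (the_inv_into {..<?n} ((!) vs) u)" for u
  have inj: "inj_on ((!) vs) {..<?n}"
    using assms by (simp add: inj_on_nth)
  have f: "f (vs ! i) = v $ i" if "i < ?n" for i
    using that by (simp add: f_def the_inv_into_f_f[OF inj])
  have vf: "v = vec ?n (\<lambda>j. f (vs ! j))"
    using v(1) f by (intro eq_vecI) auto
  obtain i where i: "i < ?n" "v $ i \<noteq> 0"
    using v(1,2) by (auto simp: vec_eq_iff)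
  then have "\<exists>u\<in>set vs. f u \<noteq> 0"
    using f[OF i(1)] nth_mem[OF i(1)] by (intro bexI[of _ "vs ! i"]) auto
  moreover have "(\<Sum>w | w \<in> set vs \<and> (u, w) \<in> parcs G. f w) = k * f u" if u: "u \<in> set vs" for u
  proof -
    obtain i where i: "i < ?n" "u = vs ! i"
      using u by (auto simp: in_set_conv_nth)
    have "(\<Sum>w | w \<in> set vs \<and> (u, w) \<in> parcs G. f w) = (adjacency_mat G vs *\<^sub>v v) $ i"
      unfolding i(2) using adjacency_mat_mult_vec[OF assms i(1), of G f] unfolding vf[symmetric]
      by (rule sym)
    also have "\<dots> = (k \<cdot>\<^sub>v v) $ i"
      unfolding v(3) ..
    also have "\<dots> = k * f u"
      using v(1) i f[OF i(1)] by simp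
    finally show ?thesis .
  qed
  ultimately show ?R by blast
next
  let ?n = "length vs"
  assume ?R
  then obtain f where f: "\<exists>u\<in>set vs. f u \<noteq> 0"
    "\<forall>u\<in>set vs. (\<Sum>w | w \<in> set vs \<and> (u, w) \<in> parcs G. f w) = k * f u" by blast
  let ?v = "vec ?n (\<lambda>j. f (vs ! j))"
  obtain i where i: "i < ?n" "f (vs ! i) \<noteq> 0"
    using f(1) by (auto simp: in_set_conv_nth)
  have "?v \<noteq> 0\<^sub>v ?n"
  proof
    assume "?v = 0\<^sub>v ?n"
    then have "?v $ i = 0\<^sub>v ?n $ i" by simp
    with i show False by simp
  qed
  moreover have "adjacency_mat G vs *\<^sub>v ?v = k \<cdot>\<^sub>v ?v"
    using adjacency_mat_mult_vec[OF assms, of _ G f] f(2)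
    by (intro eq_vecI) (auto simp: adjacency_mat_def)
  ultimately show ?L
    by (auto simp: eigenvalue_def eigenvector_def adjacency_mat_def intro!: exI[of _ ?v])
qed

lemma graph_spectral_radius_eq:
  assumes "distinct vs" and "set vs = pverts G"
  shows "graph_spectral_radius G = spectral_radius (adjacency_mat G vs)"
proof -
  define ws where "ws = (SOME vs. distinct vs \<and> set vs = pverts G)"
  have ws: "distinct ws \<and> set ws = pverts G"
    unfolding ws_def using assms by (intro someI) auto
  then have "eigenvalue (adjacency_mat G ws) k \<longleftrightarrow> eigenvalue (adjacency_mat G vs) k" for k
    using assms by (simp add: eigenvalue_adjacency_mat_iff)
  then have "spectrum (adjacency_mat G ws) = spectrum (adjacency_mat G vs)"
    unfolding spectrum_def by (intro Collect_cong)
  then show ?thesis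
    by (simp add: graph_spectral_radius_def spectral_radius_def flip: ws_def)
qed


subsection \<open>Orbits and the orbit divisor matrix\<close>

definition automorphism ::
    "'a pair_pre_digraph \<Rightarrow> ('a, 'a \<times> 'a, 'a, 'a \<times> 'a) digraph_isomorphism \<Rightarrow> bool" where
  "automorphism G \<phi> \<longleftrightarrow>
     pre_digraph.digraph_isomorphism (with_proj G) \<phi> \<and> app_iso \<phi> (with_proj G) = with_proj G"

definition automorphically_similar :: "'a pair_pre_digraph \<Rightarrow> 'a rel" where
  "automorphically_similar G =
     {(u, v). u \<in> pverts G \<and> v \<in> pverts G \<and> (\<exists>\<phi>. automorphism G \<phi> \<and> iso_verts \<phi> u = v)}"

definition orbits :: "'a pair_pre_digraph \<Rightarrow> 'a set set" where
  "orbits G = pverts G // automorphically_similar G"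

definition orbit_ordering :: "'a pair_pre_digraph \<Rightarrow> 'a set list \<Rightarrow> bool" where
  "orbit_ordering G Os \<longleftrightarrow> distinct Os \<and> set Os = orbits G"

text \<open>
  The choice of the vertex of \<open>Os ! i\<close> is irrelevant, see \<open>orbit_divisor_mat_index\<close> below.
\<close>

definition orbit_divisor_mat :: "'a pair_pre_digraph \<Rightarrow> 'a set list \<Rightarrow> nat mat" where
  "orbit_divisor_mat G Os =
     mat (length Os) (length Os)
       (\<lambda>(i, j). card {v \<in> Os ! j. ((SOME u. u \<in> Os ! i), v) \<in> parcs G})"

lemma automorphismD:
  assumes "automorphism G \<phi>"
  shows "bij_betw (iso_verts \<phi>) (pverts G) (pverts G)"
    and "(u, v) \<in> parcs G \<Longrightarrow> (iso_verts \<phi> u, iso_verts \<phi> v) \<in> parcs G"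
proof -
  have iso: "pre_digraph.digraph_isomorphism (with_proj G) \<phi>"
    and app: "app_iso \<phi> (with_proj G) = with_proj G"
    using assms by (auto simp: automorphism_def)
  have eqs: "iso_verts \<phi> ` pverts G = pverts G" "iso_arcs \<phi> ` parcs G = parcs G"
    "iso_tail \<phi> = fst" "iso_head \<phi> = snd"
    using app by (auto simp: app_iso_def with_proj_def)
  show "bij_betw (iso_verts \<phi>) (pverts G) (pverts G)"
    using iso eqs(1) by (auto simp: pre_digraph.digraph_isomorphism_def bij_betw_def)
  assume uv: "(u, v) \<in> parcs G"
  then have "iso_arcs \<phi> (u, v) = (iso_verts \<phi> u, iso_verts \<phi> v)"
    using iso eqs(3,4) by (force simp: pre_digraph.digraph_isomorphism_def prod_eq_iff)
  then show "(iso_verts \<phi> u, iso_verts \<phi> v) \<in> parcs G"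
    using uv eqs(2) by (metis imageI)
qed

lemma automorphism_id:
  assumes "pair_wf_digraph G"
  shows "\<exists>\<phi>. automorphism G \<phi> \<and> iso_verts \<phi> = id"
proof -
  let ?\<phi> = "\<lparr>iso_verts = id, iso_arcs = id, iso_head = snd, iso_tail = fst\<rparr>"
  have "pre_digraph.digraph_isomorphism (with_proj G) ?\<phi>"
    using assms by (simp add: pre_digraph.digraph_isomorphism_def wf_digraph_wp_iff)
  moreover have "app_iso ?\<phi> (with_proj G) = with_proj G"
    unfolding app_iso_def with_proj_def by simp
  ultimately show ?thesis
    by (intro exI[of _ ?\<phi>]) (simp add: automorphism_def)
qed

lemma automorphism_inv:
  assumes "pair_wf_digraph G" and "automorphism G \<phi>"
  shows "\<exists>\<psi>. automorphism G \<psi> \<and> (\<forall>u\<in>pverts G. iso_verts \<psi> (iso_verts \<phi> u) = u)"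
proof -
  interpret pair_wf_digraph G by fact
  have iso: "digraph_isomorphism \<phi>" and app: "app_iso \<phi> (with_proj G) = with_proj G"
    using assms(2) by (auto simp: automorphism_def)
  have "automorphism G (inv_iso \<phi>)"
    using digraph_isomorphism_invI[OF iso] app_iso_inv[OF iso]
    by (simp add: automorphism_def app)
  then show ?thesis
    using iso_verts_inv_iso[OF iso] by (intro exI[of _ "inv_iso \<phi>"]) auto
qed

lemma automorphism_comp:
  assumes "automorphism G \<phi>" and "automorphism G \<psi>"
  shows "\<exists>\<chi>. automorphism G \<chi> \<and> iso_verts \<chi> = iso_verts \<psi> \<circ> iso_verts \<phi>"
proof -
  have *: "wf_digraph (with_proj G)" "inj_on (iso_verts \<phi>) (pverts G)"
    "inj_on (iso_arcs \<phi>) (parcs G)" "iso_verts \<phi> ` pverts G = pverts G"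
    "iso_arcs \<phi> ` parcs G = parcs G" "iso_tail \<phi> = fst" "iso_head \<phi> = snd"
    "\<And>a. a \<in> parcs G \<Longrightarrow> iso_verts \<phi> (fst a) = fst (iso_arcs \<phi> a)"
    "\<And>a. a \<in> parcs G \<Longrightarrow> iso_verts \<phi> (snd a) = snd (iso_arcs \<phi> a)"
    if "automorphism G \<phi>" for \<phi>
    using that
    by (auto simp: automorphism_def pre_digraph.digraph_isomorphism_def app_iso_def with_proj_def)
  note f = *[OF assms(1)] and g = *[OF assms(2)]
  let ?\<chi> = "\<lparr>iso_verts = iso_verts \<psi> \<circ> iso_verts \<phi>, iso_arcs = iso_arcs \<psi> \<circ> iso_arcs \<phi>,
    iso_head = snd, iso_tail = fst\<rparr>"
  have arcs: "iso_arcs \<phi> a \<in> parcs G" if "a \<in> parcs G" for a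
    using f(5) that by blast
  have "pre_digraph.digraph_isomorphism (with_proj G) ?\<chi>"
    using f g arcs
    by (auto simp: pre_digraph.digraph_isomorphism_def intro!: comp_inj_on)
  moreover have "app_iso ?\<chi> (with_proj G) = with_proj G"
    unfolding app_iso_def with_proj_def using f(4,5) g(4,5) by (simp add: image_image[symmetric])
  ultimately show ?thesis
    by (intro exI[of _ ?\<chi>]) (simp add: automorphism_def)
qed

lemma equiv_automorphically_similar:
  assumes "pair_wf_digraph G"
  shows "equiv (pverts G) (automorphically_similar G)"
proof (rule equivI)
  show "automorphically_similar G \<subseteq> pverts G \<times> pverts G"
    by (auto simp: automorphically_similar_def)
  show "refl_on (pverts G) (automorphically_similar G)"
    using automorphism_id[OF assms] by (force simp: refl_on_def automorphically_similar_def)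
  show "sym (automorphically_similar G)"
  proof (rule symI)
    fix u v assume "(u, v) \<in> automorphically_similar G"
    then show "(v, u) \<in> automorphically_similar G"
      using automorphism_inv[OF assms] unfolding automorphically_similar_def by blast
  qed
  show "trans (automorphically_similar G)"
  proof (rule transI)
    fix u v w
    assume "(u, v) \<in> automorphically_similar G" "(v, w) \<in> automorphically_similar G"
    then obtain \<phi> \<psi> where *: "u \<in> pverts G" "w \<in> pverts G" "automorphism G \<phi>" "automorphism G \<psi>"
      "iso_verts \<psi> (iso_verts \<phi> u) = w"
      by (auto simp: automorphically_similar_def)
    from automorphism_comp[OF *(3,4)] * show "(u, w) \<in> automorphically_similar G"
      by (force simp: automorphically_similar_def)
  qed
qed

lemma card_neighbours_le:
  assumes "pair_graph G" and "O1 \<in> orbits G" and "O2 \<in> orbits G" and "u \<in> O1" and "u' \<in> O1"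
  shows "card {v \<in> O2. (u, v) \<in> parcs G} \<le> card {v \<in> O2. (u', v) \<in> parcs G}"
proof -
  interpret pair_graph G by fact
  have eq: "equiv (pverts G) (automorphically_similar G)"
    by (rule equiv_automorphically_similar) unfold_locales
  have "(u, u') \<in> automorphically_similar G"
    using quotient_eq_iff[OF eq, of O1 O1] assms(2,4,5) by (auto simp: orbits_def)
  then obtain \<phi> where \<phi>: "automorphism G \<phi>" "iso_verts \<phi> u = u'"
    by (auto simp: automorphically_similar_def)
  note bij = automorphismD(1)[OF \<phi>(1)] and arc = automorphismD(2)[OF \<phi>(1)]
  have sub: "O2 \<subseteq> pverts G"
    using assms(3) in_quotient_imp_subset[OF eq] by (simp add: orbits_def)
  have O2: "iso_verts \<phi> v \<in> O2" if "v \<in> O2" for v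
  proof -
    have "v \<in> pverts G" using that sub by blast
    then have "(v, iso_verts \<phi> v) \<in> automorphically_similar G"
      using \<phi>(1) bij by (auto simp: automorphically_similar_def bij_betw_def)
    then show ?thesis
      using in_quotient_imp_closed[OF eq] assms(3) that by (simp add: orbits_def)
  qed
  show ?thesis
  proof (rule card_inj_on_le)
    show "inj_on (iso_verts \<phi>) {v \<in> O2. (u, v) \<in> parcs G}"
      using bij sub by (auto simp: bij_betw_def intro: inj_on_subset)
    show "iso_verts \<phi> ` {v \<in> O2. (u, v) \<in> parcs G} \<subseteq> {v \<in> O2. (u', v) \<in> parcs G}"
      using O2 arc \<phi>(2) by auto
    show "finite {v \<in> O2. (u', v) \<in> parcs G}"
      using finite_subset[OF sub pair_finite_verts] by simp
  qed
qed

lemma orbit_divisor_mat_index: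
  assumes "pair_graph G" and "orbit_ordering G Os"
    and "i < length Os" and "j < length Os" and "u \<in> Os ! i"
  shows "orbit_divisor_mat G Os $$ (i, j) = card {v \<in> Os ! j. (u, v) \<in> parcs G}"
proof -
  have "Os ! i \<in> orbits G" "Os ! j \<in> orbits G"
    using assms(2-4) nth_mem by (auto simp: orbit_ordering_def)
  moreover have "(SOME u. u \<in> Os ! i) \<in> Os ! i"
    using assms(5) by (rule someI)
  ultimately show ?thesis
    using assms(1,3-5) by (simp add: orbit_divisor_mat_def antisym card_neighbours_le)
qed


subsection \<open>Orbital similarity and self-similar sequences\<close>

definition orbitally_similar :: "'a pair_pre_digraph \<Rightarrow> 'b pair_pre_digraph \<Rightarrow> bool" where
  "orbitally_similar G H \<longleftrightarrow>
     card (orbits G) = card (orbits H) \<and>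
     (\<exists>Os Ps. orbit_ordering G Os \<and> orbit_ordering H Ps \<and>
        orbit_divisor_mat G Os = orbit_divisor_mat H Ps)"

text \<open>The index set of the sequence is \<open>{1..}\<close>; the value at \<open>0\<close> is unconstrained.\<close>

definition self_similar_sequence ::
    "'a pair_pre_digraph \<Rightarrow> (nat \<Rightarrow> 'b pair_pre_digraph) \<Rightarrow> bool" where
  "self_similar_sequence G Gs \<longleftrightarrow>
     (\<forall>k\<ge>1. connected_graph (Gs k)) \<and>
     (\<forall>k\<ge>1. card (pverts (Gs k)) < card (pverts (Gs (Suc k)))) \<and>
     (\<forall>i\<ge>1. \<forall>j\<ge>1. i \<noteq> j \<longrightarrow> orbitally_similar (Gs i) (Gs j)) \<and>
     digraph_iso (with_proj (Gs 1)) (with_proj G)"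

end

theory Submission
  imports Defs
begin

text \<open>
  Let \<open>w k u\<close> be the number of walks of length \<open>k\<close> that start at \<open>u\<close>. Evaluating the eigenvalue
  equation \<open>k\<close> times at a vertex \<open>u\<close> where an eigenvector for \<open>\<mu>\<close> has maximal modulus gives
  \<open>|\<mu>|^k \<le> w k u\<close>. Conversely, if \<open>r\<close> exceeds the spectral radius, the powers of \<open>A / r\<close> are
  bounded, so that \<open>w k u = O(r^k)\<close>. Hence the spectral radius is determined by the set of
  walk-counting sequences \<open>(w k u)\<close>, \<open>k \<ge> 0\<close>. The sequence of \<open>u\<close> depends only on the orbit
  divisor matrix and the index of the orbit of \<open>u\<close>. This argument needs no positive eigenvector
  and hence no Perron--Frobenius theorem.
\<close>

section \<open>Walk counts bound eigenvalues from above\<close>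

fun num_walks :: "'a pair_pre_digraph \<Rightarrow> nat \<Rightarrow> 'a \<Rightarrow> nat" where
  "num_walks G 0 u = 1"
| "num_walks G (Suc k) u = (\<Sum>v | v \<in> pverts G \<and> (u, v) \<in> parcs G. num_walks G k v)"

text \<open>The vertex is chosen before the length \<open>k\<close>. This uniformity allows all
  powers of \<open>norm \<mu>\<close> to be compared with the walk counts of one vertex.\<close>

lemma norm_eigenvalue_power_le_num_walks:
  assumes "distinct vs" and "set vs = pverts G" and "eigenvalue (adjacency_mat G vs) \<mu>"
  shows "\<exists>u\<in>pverts G. \<forall>k. norm \<mu> ^ k \<le> real (num_walks G k u)"
proof -
  obtain f where f0: "\<exists>u\<in>pverts G. f u \<noteq> 0"
    and f: "\<And>u. u \<in> pverts G \<Longrightarrow> (\<Sum>w | w \<in> pverts G \<and> (u, w) \<in> parcs G. f w) = \<mu> * f u"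
    using assms eigenvalue_adjacency_mat_iff[OF assms(1), of G \<mu>] by auto
  have fin: "finite (pverts G)"
    using assms(2) by (metis List.finite_set)
  define M where "M = Max ((\<lambda>u. norm (f u)) ` pverts G)"
  have le_M: "norm (f u) \<le> M" if "u \<in> pverts G" for u
    unfolding M_def using fin that by (intro Max_ge) auto
  have "M \<in> (\<lambda>u. norm (f u)) ` pverts G"
    unfolding M_def using fin f0 by (intro Max_in) auto
  then obtain u where u: "u \<in> pverts G" "norm (f u) = M" by auto
  have "M > 0"
    using f0 le_M by (meson less_le_trans zero_less_norm_iff)
  \<comment> \<open>The induction passes from \<open>v\<close> to its neighbours, so the factor
    \<open>norm (f v)\<close> must be kept for arbitrary \<open>v\<close>. Only at \<open>u\<close>,
    where it equals \<open>M\<close>, can it be cancelled.\<close>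
  have bound: "norm \<mu> ^ k * norm (f v) \<le> real (num_walks G k v) * M" if "v \<in> pverts G" for k v
    using that
  proof (induction k arbitrary: v)
    case 0
    then show ?case using le_M by simp
  next
    case (Suc k)
    let ?N = "{w. w \<in> pverts G \<and> (v, w) \<in> parcs G}"
    have "norm \<mu> ^ Suc k * norm (f v) = norm \<mu> ^ k * norm (\<Sum>w\<in>?N. f w)"
      using f[OF Suc.prems] by (simp add: norm_mult)
    also have "\<dots> \<le> norm \<mu> ^ k * (\<Sum>w\<in>?N. norm (f w))"
      by (intro mult_left_mono norm_sum) auto
    also have "\<dots> = (\<Sum>w\<in>?N. norm \<mu> ^ k * norm (f w))"
      by (simp add: sum_distrib_left)
    also have "\<dots> \<le> (\<Sum>w\<in>?N. real (num_walks G k w) * M)"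
      using Suc.IH by (intro sum_mono) auto
    also have "\<dots> = real (num_walks G (Suc k) v) * M"
      by (simp add: sum_distrib_right)
    finally show ?case .
  qed
  have "norm \<mu> ^ k \<le> real (num_walks G k u)" for k
    using bound[OF u(1), of k] u(2) \<open>M > 0\<close> by simp
  with u(1) show ?thesis by blast
qed

section \<open>The spectral radius bounds the growth of walk counts\<close>

lemma smult_mat_mult_vec:
  fixes A :: "'a :: comm_semiring_0 mat"
  assumes "A \<in> carrier_mat m n" and "v \<in> carrier_vec n"
  shows "(c \<cdot>\<^sub>m A) *\<^sub>v v = c \<cdot>\<^sub>v (A *\<^sub>v v)"
  using assms by (intro eq_vecI) auto

text \<open>An eigenvector of \<open>A / r\<close> for \<open>\<mu>\<close> is an eigenvector of
  \<open>A\<close> for \<open>r * \<mu>\<close>. The rescaling puts \<open>A\<close> in the range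
  where powers stay bounded.\<close>

lemma spectral_radius_smult_less_1:
  fixes A :: "complex mat"
  assumes A: "A \<in> carrier_mat n n" and n: "n > 0" and r: "spectral_radius A < r" "r > 0"
  shows "spectral_radius (complex_of_real (1 / r) \<cdot>\<^sub>m A) < 1"
proof -
  let ?c = "complex_of_real (1 / r)"
  have cA: "?c \<cdot>\<^sub>m A \<in> carrier_mat n n" using A by simp
  obtain \<mu> where \<mu>: "\<mu> \<in> spectrum (?c \<cdot>\<^sub>m A)" "spectral_radius (?c \<cdot>\<^sub>m A) = norm \<mu>"
    using spectral_radius_mem_max(1)[OF cA n] by auto
  then obtain v where v: "v \<in> carrier_vec n" "v \<noteq> 0\<^sub>v n" "(?c \<cdot>\<^sub>m A) *\<^sub>v v = \<mu> \<cdot>\<^sub>v v"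
    using A by (auto simp: spectrum_def eigenvalue_def eigenvector_def)
  have "A *\<^sub>v v = complex_of_real r \<cdot>\<^sub>v (?c \<cdot>\<^sub>v (A *\<^sub>v v))"
    using r(2) by (simp add: smult_smult_assoc)
  also have "?c \<cdot>\<^sub>v (A *\<^sub>v v) = \<mu> \<cdot>\<^sub>v v"
    using smult_mat_mult_vec[OF A v(1), of ?c] v(3) by simp
  also have "complex_of_real r \<cdot>\<^sub>v (\<mu> \<cdot>\<^sub>v v) = (r * \<mu>) \<cdot>\<^sub>v v"
    by (simp add: smult_smult_assoc)
  finally have "r * \<mu> \<in> spectrum A"
    using A v by (auto simp: spectrum_def eigenvalue_def eigenvector_def)
  then have "norm (r * \<mu>) \<le> spectral_radius A"
    by (intro spectral_radius_mem_max(2)[OF A n]) auto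
  then have "r * norm \<mu> \<le> spectral_radius A"
    using r(2) by (simp add: norm_mult)
  also note r(1)
  finally show ?thesis
    using r(2) \<mu>(2) by simp
qed

text \<open>The walk counts of length \<open>k\<close> form the vector obtained by applying the
  \<open>k\<close>-th power of the adjacency matrix to the all-ones vector. They are thus row sums
  of that power, and those of the rescaled matrix are bounded uniformly in \<open>k\<close>.\<close>

lemma num_walks_le_power:
  assumes vs: "distinct vs" "set vs = pverts G" and ne: "pverts G \<noteq> {}"
    and r: "spectral_radius (adjacency_mat G vs) < r" "r > 0"
  shows "\<exists>C. \<forall>k. \<forall>u\<in>pverts G. real (num_walks G k u) \<le> C * r ^ k"
proof -
  let ?n = "length vs" and ?A = "adjacency_mat G vs"
  define B where "B = complex_of_real (1 / r) \<cdot>\<^sub>m ?A"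
  have A: "?A \<in> carrier_mat ?n ?n" by (simp add: adjacency_mat_def)
  then have B: "B \<in> carrier_mat ?n ?n" by (simp add: B_def)
  have n: "?n > 0" using vs ne by auto
  obtain c where c: "\<And>k. norm_bound (B ^\<^sub>m k) c"
    using spectral_radius_jnf_norm_bound_less_1_upper_triangular[OF B]
      spectral_radius_smult_less_1[OF A n r] by (auto simp: B_def)
  \<comment> \<open>Walk counts rescaled by \<open>r ^ k\<close>; \<open>f 0\<close> is the all-ones
    vector.\<close>
  define f where "f k = vec ?n (\<lambda>i. complex_of_real (num_walks G k (vs ! i) / r ^ k))" for k
  have f_carrier: "f k \<in> carrier_vec ?n" for k by (simp add: f_def)
  have step: "B *\<^sub>v f k = f (Suc k)" for k
  proof (rule eq_vecI)
    show "dim_vec (B *\<^sub>v f k) = dim_vec (f (Suc k))" using B by (simp add: f_def)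
    fix i assume "i < dim_vec (f (Suc k))"
    then have i: "i < ?n" by (simp add: f_def)
    have "(B *\<^sub>v f k) $ i = complex_of_real (1 / r) * (?A *\<^sub>v f k) $ i"
      unfolding B_def smult_mat_mult_vec[OF A f_carrier] using i A by simp
    also have "(?A *\<^sub>v f k) $ i =
        (\<Sum>w | w \<in> pverts G \<and> (vs ! i, w) \<in> parcs G. complex_of_real (num_walks G k w / r ^ k))"
      unfolding f_def
      using adjacency_mat_mult_vec[OF vs(1) i, of G "\<lambda>w. complex_of_real (num_walks G k w / r ^ k)"]
      by (simp add: vs(2))
    finally show "(B *\<^sub>v f k) $ i = f (Suc k) $ i"
      using i by (simp add: f_def sum_divide_distrib sum_distrib_left mult.commute)
  qed
  \<comment> \<open>A matrix power unfolds with the last factor on the right, next to the vector, so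
    the induction needs every start \<open>m\<close>, although only \<open>m = 0\<close> is used
    later.\<close>
  have pow: "B ^\<^sub>m k *\<^sub>v f m = f (m + k)" for k m
  proof (induction k arbitrary: m)
    case 0
    then show ?case using B f_carrier by simp
  next
    case (Suc k)
    have "B ^\<^sub>m Suc k *\<^sub>v f m = B ^\<^sub>m k *\<^sub>v (B *\<^sub>v f m)"
      using B f_carrier by (simp add: assoc_mult_mat_vec[of _ ?n ?n _ ?n])
    then show ?case using Suc step by simp
  qed
  \<comment> \<open>The constant is the number of entries in a row times the bound \<open>c\<close>
    on each entry.\<close>
  have "real (num_walks G k u) \<le> real ?n * c * r ^ k" if "u \<in> pverts G" for k u
  proof -
    obtain i where i: "i < ?n" "u = vs ! i"
      using \<open>u \<in> pverts G\<close> vs(2) by (metis in_set_conv_nth)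
    have Bk: "B ^\<^sub>m k \<in> carrier_mat ?n ?n" using B by simp
    have "complex_of_real (num_walks G k u / r ^ k) = (B ^\<^sub>m k *\<^sub>v f 0) $ i"
      unfolding pow using i by (simp add: f_def)
    also have "\<dots> = (\<Sum>j = 0..<?n. (B ^\<^sub>m k) $$ (i, j))"
      using i carrier_matD[OF Bk] by (simp add: f_def scalar_prod_def)
    finally have "real (num_walks G k u) / r ^ k = norm (\<Sum>j = 0..<?n. (B ^\<^sub>m k) $$ (i, j))"
      using r(2) by (metis abs_of_nonneg divide_nonneg_nonneg less_imp_le norm_of_real
          of_nat_0_le_iff zero_le_power)
    also have "\<dots> \<le> (\<Sum>j = 0..<?n. norm ((B ^\<^sub>m k) $$ (i, j)))"
      by (rule norm_sum)
    also have "\<dots> \<le> (\<Sum>j = 0..<?n. c)"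
      using c[of k] carrier_matD[OF Bk] i unfolding norm_bound_def by (intro sum_mono) simp
    finally show ?thesis using r(2) by (simp add: field_simps)
  qed
  then show ?thesis by blast
qed

section \<open>Comparing spectral radii through walk counts\<close>

lemma power_bounded_imp_le_1:
  fixes x :: real
  assumes "\<And>k. x ^ k \<le> C"
  shows "x \<le> 1"
  using assms real_arch_pow[of x C] by (meson not_le)

text \<open>For an eigenvalue \<open>\<mu>\<close> of \<open>H\<close> of largest modulus,
  \<open>norm \<mu> ^ k\<close> is at most a walk count of \<open>H\<close>, which is also one of
  \<open>G\<close> and hence \<open>O(r ^ k)\<close> for each \<open>r\<close> above the spectral
  radius of \<open>G\<close>. One-sided matching gives one inequality; equality comes from using it
  both ways.\<close>

lemma graph_spectral_radius_le:
  assumes fin: "finite (pverts G)" "finite (pverts H)"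
    and ne: "pverts G \<noteq> {}" "pverts H \<noteq> {}"
    and walks: "\<And>u. u \<in> pverts H \<Longrightarrow> \<exists>u'\<in>pverts G. \<forall>k. num_walks H k u = num_walks G k u'"
  shows "graph_spectral_radius H \<le> graph_spectral_radius G"
proof -
  obtain vs where vs: "distinct vs" "set vs = pverts G"
    using finite_distinct_list[OF fin(1)] by blast
  obtain us where us: "distinct us" "set us = pverts H"
    using finite_distinct_list[OF fin(2)] by blast
  let ?A = "adjacency_mat G vs" and ?B = "adjacency_mat H us"
  have carrier: "?A \<in> carrier_mat (length vs) (length vs)" "?B \<in> carrier_mat (length us) (length us)"
    by (simp_all add: adjacency_mat_def)
  have len: "length vs > 0" "length us > 0" using vs us ne by auto
  have "0 \<le> spectral_radius ?A"
    using spectral_radius_mem_max(1)[OF carrier(1) len(1)] by auto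
  obtain \<mu> where \<mu>: "eigenvalue ?B \<mu>" "spectral_radius ?B = norm \<mu>"
    using spectral_radius_mem_max(1)[OF carrier(2) len(2)] by (auto simp: spectrum_def)
  obtain u where "u \<in> pverts H" "\<And>k. norm \<mu> ^ k \<le> real (num_walks H k u)"
    using norm_eigenvalue_power_le_num_walks[OF us \<mu>(1)] by blast
  then obtain u' where u': "u' \<in> pverts G" "\<And>k. norm \<mu> ^ k \<le> real (num_walks G k u')"
    using walks by metis
  \<comment> \<open>Boundedness of the rescaled powers was obtained for \<open>r\<close> strictly
    above the spectral radius, so the bound there is reached as a limit.\<close>
  have "norm \<mu> \<le> r" if r: "spectral_radius ?A < r" for r
  proof -
    have "r > 0" using r \<open>0 \<le> spectral_radius ?A\<close> by simp
    obtain C where "\<And>k. real (num_walks G k u') \<le> C * r ^ k"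
      using num_walks_le_power[OF vs ne(1) r \<open>r > 0\<close>] u'(1) by blast
    then have "norm \<mu> ^ k \<le> C * r ^ k" for k
      using u'(2) order_trans by blast
    then have "(norm \<mu> / r) ^ k \<le> C" for k
      using \<open>r > 0\<close> by (simp add: power_divide divide_le_eq)
    then have "norm \<mu> / r \<le> 1" by (rule power_bounded_imp_le_1)
    then show ?thesis using \<open>r > 0\<close> by simp
  qed
  then have "norm \<mu> \<le> spectral_radius ?A" by (rule dense_ge)
  then show ?thesis
    using \<mu>(2) graph_spectral_radius_eq[OF vs] graph_spectral_radius_eq[OF us] by simp
qed

section \<open>Walk counts from the orbit divisor matrix\<close>

text \<open>For square \<open>S\<close> and a row index \<open>i\<close>, this is the sum of row
  \<open>i\<close> of the \<open>k\<close>-th power of \<open>S\<close>.\<close>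

fun divisor_walks :: "nat mat \<Rightarrow> nat \<Rightarrow> nat \<Rightarrow> nat" where
  "divisor_walks S 0 i = 1"
| "divisor_walks S (Suc k) i = (\<Sum>j<dim_row S. S $$ (i, j) * divisor_walks S k j)"

text \<open>The orbits partition the vertices, so the sum over the neighbours of \<open>u\<close>
  splits by orbit. Shorter walk counts are constant on each orbit by induction, and the number of
  neighbours in an orbit is a matrix entry.\<close>

lemma num_walks_eq_divisor_walks:
  assumes "pair_graph G" and Os: "orbit_ordering G Os" and "i < length Os" and "u \<in> Os ! i"
  shows "num_walks G k u = divisor_walks (orbit_divisor_mat G Os) k i"
  using assms(3,4)
proof (induction k arbitrary: i u)
  case (Suc k)
  interpret pair_graph G by fact
  let ?S = "orbit_divisor_mat G Os"
  have eq: "equiv (pverts G) (automorphically_similar G)"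
    by (rule equiv_automorphically_similar) unfold_locales
  have dist: "distinct Os" and set: "set Os = pverts G // automorphically_similar G"
    using Os by (auto simp: orbit_ordering_def orbits_def)
  have union: "pverts G = (\<Union>j<length Os. Os ! j)"
  proof -
    have "(\<Union>j<length Os. Os ! j) = \<Union> (set Os)"
      unfolding set_conv_nth by auto
    then show ?thesis using Union_quotient[OF eq] set by simp
  qed
  have disj: "Os ! j \<inter> Os ! j' = {}" if "j < length Os" "j' < length Os" "j \<noteq> j'" for j j'
  proof -
    have "Os ! j \<in> pverts G // automorphically_similar G"
      "Os ! j' \<in> pverts G // automorphically_similar G"
      using that nth_mem set by auto
    then show ?thesis
      using quotient_disj[OF eq] nth_eq_iff_index_eq[OF dist] that by metis
  qed
  have "num_walks G (Suc k) u = (\<Sum>v\<in>(\<Union>j<length Os. {v \<in> Os ! j. (u, v) \<in> parcs G}). num_walks G k v)"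
    unfolding num_walks.simps by (rule sum.cong) (auto simp: union)
  also have "\<dots> = (\<Sum>j<length Os. \<Sum>v | v \<in> Os ! j \<and> (u, v) \<in> parcs G. num_walks G k v)"
  proof (rule sum.UNION_disjoint)
    show "\<forall>j\<in>{..<length Os}. finite {v \<in> Os ! j. (u, v) \<in> parcs G}"
      using pair_finite_verts by (auto simp: union)
    show "\<forall>j\<in>{..<length Os}. \<forall>j'\<in>{..<length Os}. j \<noteq> j' \<longrightarrow>
      {v \<in> Os ! j. (u, v) \<in> parcs G} \<inter> {v \<in> Os ! j'. (u, v) \<in> parcs G} = {}"
      using disj by fast
  qed simp
  also have "\<dots> = (\<Sum>j<length Os. card {v \<in> Os ! j. (u, v) \<in> parcs G} * divisor_walks ?S k j)"
    using Suc.IH by (intro sum.cong) simp_all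
  also have "\<dots> = (\<Sum>j<length Os. ?S $$ (i, j) * divisor_walks ?S k j)"
    using orbit_divisor_mat_index[OF assms(1,2) Suc.prems(1) _ Suc.prems(2)]
    by (intro sum.cong) simp_all
  also have "\<dots> = divisor_walks ?S (Suc k) i"
    by (simp add: orbit_divisor_mat_def)
  finally show ?case .
qed simp

section \<open>Orbitally similar graphs and isomorphic graphs\<close>

lemma connected_graphD:
  assumes "connected_graph G"
  shows "pair_graph G" and "finite (pverts G)" and "pverts G \<noteq> {}"
proof -
  show "pair_graph G" using assms by (simp add: connected_graph_def)
  then interpret pair_graph G .
  show "finite (pverts G)" by (rule pair_finite_verts)
  show "pverts G \<noteq> {}"
    using assms by (auto simp: connected_graph_def connected_def strongly_connected_def)
qed

lemma orbitally_similar_sym: "orbitally_similar G H \<Longrightarrow> orbitally_similar H G"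
  unfolding orbitally_similar_def by metis

text \<open>Equal divisor matrices give equal counts at orbits with the same index, so any vertex of
  the corresponding orbit of \<open>G\<close> serves as \<open>u'\<close>.\<close>

lemma orbitally_similar_num_walks:
  assumes "pair_graph G" and "pair_graph H" and "orbitally_similar H G" and "u \<in> pverts H"
  shows "\<exists>u'\<in>pverts G. \<forall>k. num_walks H k u = num_walks G k u'"
proof -
  interpret G: pair_graph G by fact
  interpret H: pair_graph H by fact
  obtain Ps Os where Ps: "orbit_ordering H Ps" and Os: "orbit_ordering G Os"
    and eq: "orbit_divisor_mat H Ps = orbit_divisor_mat G Os"
    using assms(3) by (auto simp: orbitally_similar_def)
  have "length Ps = length Os"
    using arg_cong[OF eq, of dim_row] by (simp add: orbit_divisor_mat_def)
  have eqG: "equiv (pverts G) (automorphically_similar G)"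
    and eqH: "equiv (pverts H) (automorphically_similar H)"
    by (rule equiv_automorphically_similar; unfold_locales)+
  have "u \<in> \<Union> (set Ps)"
    using Ps assms(4) Union_quotient[OF eqH] by (simp add: orbit_ordering_def orbits_def)
  then obtain i where i: "i < length Ps" "u \<in> Ps ! i"
    by (auto simp: in_set_conv_nth)
  with \<open>length Ps = length Os\<close> have i': "i < length Os" by simp
  then have "Os ! i \<in> pverts G // automorphically_similar G"
    using Os nth_mem by (auto simp: orbit_ordering_def orbits_def)
  then obtain u' where u': "u' \<in> Os ! i" "u' \<in> pverts G"
    using in_quotient_imp_non_empty[OF eqG] in_quotient_imp_subset[OF eqG] by blast
  have "num_walks H k u = num_walks G k u'" for k
    using num_walks_eq_divisor_walks[OF assms(2) Ps i] eq
      num_walks_eq_divisor_walks[OF assms(1) Os i' u'(1)] by simp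
  with u'(2) show ?thesis by blast
qed

lemma orbitally_similar_graph_spectral_radius_eq:
  assumes "connected_graph G" and "connected_graph H" and "orbitally_similar H G"
  shows "graph_spectral_radius H = graph_spectral_radius G"
proof -
  note G = connected_graphD[OF assms(1)] and H = connected_graphD[OF assms(2)]
  show ?thesis
    using orbitally_similar_num_walks[OF G(1) H(1) assms(3)]
      orbitally_similar_num_walks[OF H(1) G(1) orbitally_similar_sym[OF assms(3)]]
    by (intro antisym graph_spectral_radius_le G H)
qed

text \<open>Links the first graph of a self-similar sequence, which is only isomorphic to
  \<open>G\<close>, to \<open>G\<close> directly through walks, without transporting orbits.\<close>

lemma digraph_iso_num_walks:
  assumes "pair_graph G" and "digraph_iso (with_proj G) (with_proj H)"
  shows "\<exists>h. h ` pverts G = pverts H \<and> (\<forall>u\<in>pverts G. \<forall>k. num_walks H k (h u) = num_walks G k u)"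
proof -
  interpret pair_graph G by fact
  obtain \<phi> where iso: "pre_digraph.digraph_isomorphism (with_proj G) \<phi>"
    and app: "with_proj H = app_iso \<phi> (with_proj G)"
    using assms(2) by (auto simp: digraph_iso_def)
  let ?h = "iso_verts \<phi>"
  have verts: "?h ` pverts G = pverts H" and arcs: "iso_arcs \<phi> ` parcs G = parcs H"
    and proj: "iso_tail \<phi> = fst" "iso_head \<phi> = snd"
    using app by (auto simp: app_iso_def with_proj_def)
  have inj: "inj_on ?h (pverts G)"
    using iso by (auto simp: pre_digraph.digraph_isomorphism_def)
  \<comment> \<open>Both digraphs have \<open>fst\<close> and \<open>snd\<close> as tail and head
    maps, so the separate arc map is determined by the vertex map.\<close>
  have arc: "iso_arcs \<phi> (u, v) = (?h u, ?h v)" if "(u, v) \<in> parcs G" for u v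
    using that iso proj by (force simp: pre_digraph.digraph_isomorphism_def prod_eq_iff)
  have arc_iff: "(?h u, ?h v) \<in> parcs H \<longleftrightarrow> (u, v) \<in> parcs G"
    if "u \<in> pverts G" "v \<in> pverts G" for u v
  proof
    assume "(?h u, ?h v) \<in> parcs H"
    then obtain x y where xy: "(x, y) \<in> parcs G" "iso_arcs \<phi> (x, y) = (?h u, ?h v)"
      unfolding arcs[symmetric] by force
    then have "?h x = ?h u" "?h y = ?h v" using arc by auto
    moreover have "x \<in> pverts G" "y \<in> pverts G" using xy(1) in_arcsD1 in_arcsD2 by auto
    ultimately show "(u, v) \<in> parcs G" using inj that xy(1) by (metis inj_onD)
  next
    assume "(u, v) \<in> parcs G"
    then show "(?h u, ?h v) \<in> parcs H" using arc arcs by (metis imageI)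
  qed
  have "num_walks H k (?h u) = num_walks G k u" if "u \<in> pverts G" for k u
    using that
  proof (induction k arbitrary: u)
    case (Suc k)
    let ?N = "{v. v \<in> pverts G \<and> (u, v) \<in> parcs G}"
    have "{v. v \<in> pverts H \<and> (?h u, v) \<in> parcs H} = ?h ` ?N"
      using arc_iff[OF Suc.prems] by (auto simp: verts[symmetric])
    moreover have "inj_on ?h ?N"
      using inj by (rule inj_on_subset) auto
    ultimately show ?case
      using Suc.IH by (simp add: sum.reindex)
  qed simp
  with verts show ?thesis by blast
qed

lemma digraph_iso_graph_spectral_radius_eq:
  assumes "connected_graph G" and "connected_graph H"
    and "digraph_iso (with_proj G) (with_proj H)"
  shows "graph_spectral_radius G = graph_spectral_radius H"
proof -
  note G = connected_graphD[OF assms(1)] and H = connected_graphD[OF assms(2)]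
  obtain h where h: "h ` pverts G = pverts H"
    "\<And>u k. u \<in> pverts G \<Longrightarrow> num_walks H k (h u) = num_walks G k u"
    using digraph_iso_num_walks[OF G(1) assms(3)] by blast
  show ?thesis
  proof (intro antisym graph_spectral_radius_le G H)
    show "\<exists>u'\<in>pverts H. \<forall>k. num_walks G k u = num_walks H k u'" if "u \<in> pverts G" for u
      using h that by (metis imageI)
    show "\<exists>u'\<in>pverts G. \<forall>k. num_walks H k u = num_walks G k u'" if "u \<in> pverts H" for u
      using h that by (metis imageE)
  qed
qed

theorem theorem3:
  fixes G :: "'a pair_pre_digraph"
  assumes "connected_graph G"
  shows "(\<forall>H :: 'b pair_pre_digraph.
            connected_graph H \<and> orbitally_similar H G \<longrightarrow>
            graph_spectral_radius H = graph_spectral_radius G) \<and>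
         (\<forall>Gs :: nat \<Rightarrow> 'c pair_pre_digraph.
            self_similar_sequence G Gs \<longrightarrow>
            (\<forall>k\<ge>1. graph_spectral_radius (Gs k) = graph_spectral_radius G))"
proof (intro conjI allI impI)
  fix H :: "'b pair_pre_digraph"
  assume "connected_graph H \<and> orbitally_similar H G"
  then show "graph_spectral_radius H = graph_spectral_radius G"
    using orbitally_similar_graph_spectral_radius_eq[OF assms] by blast
next
  fix Gs :: "nat \<Rightarrow> 'c pair_pre_digraph" and k :: nat
  assume *: "self_similar_sequence G Gs" and "1 \<le> k"
  then have conn: "connected_graph (Gs k)" "connected_graph (Gs 1)"
    by (auto simp: self_similar_sequence_def)
  have "graph_spectral_radius (Gs k) = graph_spectral_radius (Gs 1)"
  \<comment> \<open>A self-similar sequence provides orbital similarity only for distinct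
    indices.\<close>
  proof (cases "k = 1")
    case False
    then have "orbitally_similar (Gs k) (Gs 1)"
      using * \<open>1 \<le> k\<close> by (simp add: self_similar_sequence_def)
    then show ?thesis
      by (rule orbitally_similar_graph_spectral_radius_eq[OF conn(2,1)])
  qed simp
  also have "\<dots> = graph_spectral_radius G"
    using * conn(2) assms
    by (intro digraph_iso_graph_spectral_radius_eq) (auto simp: self_similar_sequence_def)
  finally show "graph_spectral_radius (Gs k) = graph_spectral_radius G" .
qed

end
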